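(* Let $(M,d)$ be a metric space, and let $\mathrm{der}(M)$ denote the set of all limit points of $M$. Then the following are equivalent: (i) $(M,d)$ is uniformly continuous, i.e. every continuous function $f: M\to\mathbb{R}$ is uniformly continuous; (ii) $\mathrm{der}(M)$ is compact, and for every $\varepsilon>0$ the set $M\setminus B(\mathrm{der}(M),\varepsilon)$ is uniformly isolated.
   Context: A metric space $(M,d)$ is called uniformly continuous if every real-valued continuous function on $M$ is uniformly continuous ($\mathbb{R}$ carries its usual metric). A subset $E$ of a metric space $(M,d)$ is uniformly isolated if there exists a real number $\eta>0$ such that $d(p,q)\geq\eta$ for all $p\neq q$ in $E$. The derived set $\mathrm{der}(M)$ is the set of all limit points of $(M,d)$, i.e. the points $x\in M$ such that every open ball centered at $x$ contains a point of $M$ other than $x$. For $\varepsilon>0$, $B(\mathrm{der}(M),\varepsilon)=\bigcup_{x\in\mathrm{der}(M)}B(x,\varepsilon)$, where $B(x,\varepsilon)=\{y\in M: d(x,y)<\varepsilon\}$. When $\mathrm{der}(M)=\emptyset$ (which counts as compact), $B(\mathrm{der}(M),\varepsilon)=\emptyset$, so $M\setminus B(\mathrm{der}(M),\varepsilon)=M$. *)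

theory Defs
  imports "HOL-Analysis.Analysis"
begin

definition uniformly_continuous_space :: "'a metric \<Rightarrow> bool" where
  "uniformly_continuous_space m \<longleftrightarrow>
     (\<forall>f :: 'a \<Rightarrow> real. continuous_map (mtopology_of m) euclideanreal f
        \<longrightarrow> uniformly_continuous_map m euclidean_metric f)"

definition uniformly_isolated :: "'a metric \<Rightarrow> 'a set \<Rightarrow> bool" where
  "uniformly_isolated m E \<longleftrightarrow>
     E \<subseteq> mspace m \<and> (\<exists>\<eta>>0. \<forall>p\<in>E. \<forall>q\<in>E. p \<noteq> q \<longrightarrow> mdist m p q \<ge> \<eta>)"

definition der :: "'a metric \<Rightarrow> 'a set" where
  "der m = mtopology_of m derived_set_of mspace m"

lemma der_eq_balls:
  "der m = {x \<in> mspace m. \<forall>r>0. \<exists>y\<in>mball_of m x r. y \<noteq> x}"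
proof -
  interpret Metric_space "mspace m" "mdist m"
    by simp
  show ?thesis
    unfolding der_def mtopology_of_def mball_of_def metric_derived_set_of
    using mball_subset_mspace by blast
qed

definition ball_around :: "'a metric \<Rightarrow> 'a set \<Rightarrow> real \<Rightarrow> 'a set" where
  "ball_around m S \<epsilon> = (\<Union>x\<in>S. mball_of m x \<epsilon>)"

end

theory Submission
  imports Defs
begin

text \<open>
  In a uniformly continuous space a set F without limit points must be uniformly isolated:
  otherwise F contains pairs of distinct points \<open>p n\<close>, \<open>q n\<close> at distance tending to 0, and the
  countable set of all these points is closed and discrete, so an injection of it into the naturals
  extends by Tietze to a continuous real function that jumps by at least 1 on every pair. This
  applies to the complement of a ball around the derived set. It also gives compactness of the
  derived set: an infinite set T of limit points without a limit point of its own would be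
  uniformly isolated, and attaching to points \<open>x n\<close> of T ever closer neighbours \<open>y n\<close>
  still creates no limit point, yet destroys uniform isolation.

  Conversely, a Lebesgue number of a cover of the derived set controls a continuous function near
  the derived set, and away from it two sufficiently close points are equal.
\<close>

lemma uniformly_isolated_if_no_limit_points:
  assumes uc: "uniformly_continuous_space m" and F: "F \<subseteq> mspace m"
    and nolim: "mtopology_of m derived_set_of F = {}"
  shows "uniformly_isolated m F"
proof (rule ccontr)
  assume "\<not> uniformly_isolated m F"
  then have "\<forall>\<eta>>0. \<exists>p\<in>F. \<exists>q\<in>F. p \<noteq> q \<and> mdist m p q < \<eta>"
    using F unfolding uniformly_isolated_def by force
  then have "\<exists>p q. p \<in> F \<and> q \<in> F \<and> p \<noteq> q \<and> mdist m p q < inverse (real (Suc n))" for n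
    by (metis inverse_positive_iff_positive of_nat_0_less_iff zero_less_Suc)
  then obtain p q where pq: "\<And>n. p n \<in> F" "\<And>n. q n \<in> F" "\<And>n. p n \<noteq> q n"
      "\<And>n::nat. mdist m (p n) (q n) < inverse (real (Suc n))"
    by metis
  define S where "S = range p \<union> range q"
  \<comment> \<open>Countability of \<open>S\<close> makes \<open>to_nat_on S\<close> injective on
    it, so \<open>h\<close> takes values at distance at least 1 at distinct points of
    \<open>S\<close>.\<close>
  define h :: "'a \<Rightarrow> real" where "h = (\<lambda>x. real (to_nat_on S x))"
  have "S \<subseteq> F" "countable S"
    using pq by (auto simp: S_def)
  have SM: "S \<subseteq> mspace m" and S0: "mtopology_of m derived_set_of S = {}"
    using \<open>S \<subseteq> F\<close> F nolim derived_set_of_mono by blast+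
  have metr: "metrizable_space (mtopology_of m)"
    by (simp add: Metric_space.metrizable_space_mtopology mtopology_of_def)
  have "subtopology (mtopology_of m) S = discrete_topology S"
    using S0 SM by (simp add: subtopology_eq_discrete_topology_eq)
  then have "continuous_map (subtopology (mtopology_of m) S) euclideanreal h"
    by simp
  moreover have "closedin (mtopology_of m) S"
    using SM S0 by (simp add: closedin_contains_derived_set)
  \<comment> \<open>Since \<open>h\<close> may be unbounded, the target interval for Tietze is the
    whole line.\<close>
  ultimately obtain g where
      g: "continuous_map (mtopology_of m) euclideanreal g" "\<And>x. x \<in> S \<Longrightarrow> g x = h x"
    using Tietze_extension_realinterval[of "mtopology_of m" S UNIV h]
      metrizable_imp_normal_space[OF metr] by (metis UNIV_not_empty is_interval_univ subset_UNIV)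
  then have "uniformly_continuous_map m euclidean_metric g"
    using uc by (simp add: uniformly_continuous_space_def)
  then obtain \<delta> where "\<delta> > 0" and
      \<delta>: "\<And>x y. \<lbrakk>x \<in> mspace m; y \<in> mspace m; mdist m y x < \<delta>\<rbrakk> \<Longrightarrow> dist (g y) (g x) < 1"
    unfolding uniformly_continuous_map_def by (metis mdist_euclidean_metric zero_less_one)
  obtain n where "inverse (real (Suc n)) < \<delta>"
    using reals_Archimedean[OF \<open>\<delta> > 0\<close>] by blast
  then have "dist (g (p n)) (g (q n)) < 1"
    using \<delta> pq F by (meson less_trans subsetD)
  moreover have "p n \<in> S" "q n \<in> S"
    by (auto simp: S_def)
  \<comment> \<open>Two naturals at distance less than 1 coincide, which is why 1 was chosen as the
    tolerance for \<open>g\<close>.\<close>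
  ultimately have "to_nat_on S (p n) = to_nat_on S (q n)"
    by (auto simp: g h_def dist_real_def)
  then show False
    using inj_on_to_nat_on[OF \<open>countable S\<close>] \<open>p n \<in> S\<close> \<open>q n \<in> S\<close> pq(3) by (meson inj_onD)
qed

text \<open>A limit point \<open>z\<close> of the complement is also a limit point of the space, so
  its whole \<epsilon>-ball has been removed and no point of the complement comes that close to
  \<open>z\<close>.\<close>

lemma derived_set_Compl_ball_around_der:
  assumes "\<epsilon> > 0"
  shows "mtopology_of m derived_set_of (mspace m - ball_around m (der m) \<epsilon>) = {}"
proof -
  interpret Metric_space "mspace m" "mdist m"
    by simp
  have False if z: "z \<in> mtopology derived_set_of (mspace m - ball_around m (der m) \<epsilon>)" for z
  proof -
    have "z \<in> der m"
      using subsetD[OF derived_set_of_mono[OF Diff_subset] z] by (simp add: der_def mtopology_of_def)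
    moreover obtain y where "y \<in> mspace m - ball_around m (der m) \<epsilon>" "y \<in> mball z \<epsilon>"
      using z assms unfolding metric_derived_set_of by blast
    ultimately show False
      by (auto simp: ball_around_def mball_of_def)
  qed
  then show ?thesis
    by (auto simp: mtopology_of_def)
qed

lemma compactin_der_if_uniformly_continuous_space:
  assumes uc: "uniformly_continuous_space m"
  shows "compactin (mtopology_of m) (der m)"
proof -
  interpret Metric_space "mspace m" "mdist m"
    by simp
  have top: "mtopology_of m = mtopology"
    by (simp add: mtopology_of_def)
  have dM: "der m \<subseteq> mspace m"
    by (auto simp: der_eq_balls)
  \<comment> \<open>This is the Bolzano-Weierstrass criterion for compactness of
    \<open>der m\<close>.\<close>
  have "der m \<inter> mtopology derived_set_of T \<noteq> {}" if T: "T \<subseteq> der m" "infinite T" for T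
  proof
    assume "der m \<inter> mtopology derived_set_of T = {}"
    \<comment> \<open>Limit points of \<open>T\<close> are limit points of the space, so having none
      in \<open>der m\<close> means having none at all.\<close>
    then have T0: "mtopology derived_set_of T = {}"
      using T(1) dM derived_set_of_mono[of T "mspace m" mtopology]
      by (auto simp: der_def top)
    then obtain \<eta> where "\<eta> > 0" and
        \<eta>: "\<And>p q. \<lbrakk>p \<in> T; q \<in> T; p \<noteq> q\<rbrakk> \<Longrightarrow> mdist m p q \<ge> \<eta>"
      using uniformly_isolated_if_no_limit_points[OF uc, of T] T(1) dM
      unfolding uniformly_isolated_def top by blast
    obtain x :: "nat \<Rightarrow> 'a" where x: "inj x" "range x \<subseteq> T"
      using infinite_countable_subset[OF T(2)] by blast
    have xder: "x n \<in> der m" for n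
      using x(2) T(1) by auto
    have "\<exists>y\<in>mball_of m (x n) (inverse (real (Suc n))). y \<noteq> x n" for n
      using xder[of n] unfolding der_eq_balls by simp
    then obtain y where y: "\<And>n::nat. y n \<in> mball (x n) (inverse (real (Suc n)))" "\<And>n. y n \<noteq> x n"
      unfolding mball_of_def by metis
    define F where "F = range x \<union> range y"
    have FM: "F \<subseteq> mspace m"
      using xder dM y(1) by (auto simp: F_def)
    \<comment> \<open>The path from \<open>x i\<close> to \<open>x j\<close> via \<open>y i\<close>,
      \<open>z\<close> and \<open>y j\<close> has four legs. If each is shorter than \<eta>/4, the
      separation \<eta> of distinct points of \<open>T\<close> is violated.\<close>
    obtain N where N: "inverse (real (Suc N)) < \<eta>/4"
      using reals_Archimedean \<open>\<eta> > 0\<close> by (metis divide_pos_pos zero_less_numeral)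
    have close: "mdist m (x n) (y n) < \<eta>/4" if "n \<ge> N" for n
    proof -
      have "inverse (real (Suc n)) \<le> inverse (real (Suc N))"
        using that by (simp add: field_simps)
      moreover have "mdist m (x n) (y n) < inverse (real (Suc n))"
        using y(1)[of n] by simp
      ultimately show ?thesis
        using N by linarith
    qed
    \<comment> \<open>Every ball around a limit point would contain infinitely many points of
      \<open>range y\<close>. A ball of radius \<eta>/4 contains \<open>y i\<close> for at most one
      index \<open>i\<close> from \<open>N\<close> on, besides finitely many earlier terms.\<close>
    have "mtopology derived_set_of range y = {}"
    proof -
      have "finite (range y \<inter> mball z (\<eta>/4))" if "z \<in> mspace m" for z
      proof -
        have same: "i = j" if "i \<ge> N" "j \<ge> N" "y i \<in> mball z (\<eta>/4)" "y j \<in> mball z (\<eta>/4)" for i j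
        proof (rule ccontr)
          assume "i \<noteq> j"
          then have "\<eta> \<le> mdist m (x i) (x j)"
            using \<eta> x by (metis injD range_subsetD)
          also have "\<dots> \<le> mdist m (x i) (y i) + mdist m (y i) z + mdist m z (y j) + mdist m (y j) (x j)"
            using triangle[of "x i" "y i" "x j"] triangle[of "y i" z "x j"] triangle[of z "y j" "x j"]
              that(3,4) xder dM by fastforce
          also have "\<dots> < \<eta>"
            using close[OF that(1)] close[OF that(2)] that(3,4) by (auto simp: commute)
          finally show False
            by simp
        qed
        have "finite {i. i \<ge> N \<and> y i \<in> mball z (\<eta>/4)}" (is "finite ?I")
        proof (cases "?I = {}")
          case False
          then obtain i where "i \<in> ?I"
            by blast
          then have "?I \<subseteq> {i}"
            using same by blast
          then show ?thesis
            using finite_subset by blast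
        qed (simp only: finite.emptyI)
        then have "finite (y ` ({..<N} \<union> {i. i \<ge> N \<and> y i \<in> mball z (\<eta>/4)}))"
          by blast
        moreover have "range y \<inter> mball z (\<eta>/4) \<subseteq> y ` ({..<N} \<union> {i. i \<ge> N \<and> y i \<in> mball z (\<eta>/4)})"
          by (auto simp: not_less)
        ultimately show ?thesis
          using finite_subset by blast
      qed
      then show ?thesis
        unfolding derived_set_of_infinite_mball using \<open>\<eta> > 0\<close>
        by (metis (no_types, lifting) divide_pos_pos empty_Collect_eq zero_less_numeral)
    qed
    moreover have "mtopology derived_set_of range x = {}"
      using T0 derived_set_of_mono[OF x(2)] by blast
    ultimately have "mtopology derived_set_of F = {}"
      by (simp add: F_def derived_set_of_Un)
    then obtain \<theta> where "\<theta> > 0" and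
        \<theta>: "\<And>p q. \<lbrakk>p \<in> F; q \<in> F; p \<noteq> q\<rbrakk> \<Longrightarrow> mdist m p q \<ge> \<theta>"
      using uniformly_isolated_if_no_limit_points[OF uc FM]
      unfolding uniformly_isolated_def top by blast
    obtain n where n: "inverse (real (Suc n)) < \<theta>"
      using reals_Archimedean[OF \<open>\<theta> > 0\<close>] by blast
    have "mdist m (x n) (y n) \<ge> \<theta>"
      using \<theta>[of "x n" "y n"] y(2)[of n] by (auto simp: F_def)
    then show False
      using y(1)[of n] n by simp
  qed
  then show ?thesis
    using dM by (simp add: top compactin_eq_Bolzano_Weierstrass)
qed

lemma uniformly_continuous_space_if_compactin_der:
  assumes comp: "compactin (mtopology_of m) (der m)"
    and iso: "\<And>\<epsilon>. \<epsilon> > 0 \<Longrightarrow> uniformly_isolated m (mspace m - ball_around m (der m) \<epsilon>)"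
  shows "uniformly_continuous_space m"
  unfolding uniformly_continuous_space_def
proof (intro allI impI)
  interpret Metric_space "mspace m" "mdist m"
    by simp
  fix f :: "'a \<Rightarrow> real"
  assume "continuous_map (mtopology_of m) euclideanreal f"
  then have contf: "\<exists>\<delta>>0. \<forall>x. x \<in> mspace m \<and> mdist m a x < \<delta> \<longrightarrow> dist (f a) (f x) < e"
    if "a \<in> mspace m" "e > 0" for a e
    using metric_continuous_map[OF Met_TC.Metric_space_axioms, of f] that
    by (simp add: mtopology_of_def)
  have "\<exists>\<delta>>0. \<forall>x\<in>mspace m. \<forall>y\<in>mspace m. mdist m y x < \<delta> \<longrightarrow> dist (f y) (f x) < e"
    if "e > 0" for e
  proof -
    \<comment> \<open>With e/2 here, any two points in a common ball around \<open>a\<close> have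
      values less than e apart.\<close>
    have "\<forall>a\<in>der m. \<exists>\<delta>>0. \<forall>x. x \<in> mspace m \<and> mdist m a x < \<delta> \<longrightarrow> dist (f a) (f x) < e/2"
      using contf[of _ "e/2"] that by (auto simp: der_eq_balls)
    then obtain \<delta> where \<delta>: "\<And>a. a \<in> der m \<Longrightarrow> \<delta> a > 0"
        "\<And>a x. \<lbrakk>a \<in> der m; x \<in> mspace m; mdist m a x < \<delta> a\<rbrakk> \<Longrightarrow> dist (f a) (f x) < e/2"
      by metis
    have "der m \<subseteq> (\<Union>a\<in>der m. mball a (\<delta> a))"
      using \<delta>(1) by (force simp: der_eq_balls)
    then obtain \<rho> where "\<rho> > 0" and \<rho>: "\<And>x. x \<in> der m \<Longrightarrow> \<exists>a\<in>der m. mball x \<rho> \<subseteq> mball a (\<delta> a)"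
      using lebesgue_number[of "der m" "(\<lambda>a. mball a (\<delta> a)) ` der m"] comp
      by (fastforce simp: mtopology_of_def)
    \<comment> \<open>The Lebesgue number \<rho> is halved so that a point within \<rho>/2 of some
      \<open>x\<close> in \<open>der m\<close>, and any point within \<rho>/2 of that one, both lie
      in the \<rho>-ball of \<open>x\<close>. If \<open>der m\<close> is empty, \<eta> separates the
      points of the whole space.\<close>
    then obtain \<eta> where "\<eta> > 0" and
        \<eta>: "\<And>p q. \<lbrakk>p \<in> mspace m - ball_around m (der m) (\<rho>/2);
          q \<in> mspace m - ball_around m (der m) (\<rho>/2); p \<noteq> q\<rbrakk> \<Longrightarrow> mdist m p q \<ge> \<eta>"
      using iso[of "\<rho>/2"] unfolding uniformly_isolated_def by auto
    have near: "dist (f p) (f q) < e"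
      if p: "p \<in> ball_around m (der m) (\<rho>/2)" and q: "q \<in> mspace m" "mdist m p q < \<rho>/2" for p q
    proof -
      obtain x where x: "x \<in> der m" "p \<in> mball x (\<rho>/2)"
        using p by (auto simp: ball_around_def mball_of_def)
      then have "p \<in> mball x \<rho>" "q \<in> mball x \<rho>"
        using triangle[of x p q] q \<open>\<rho> > 0\<close> by auto
      then obtain a where "a \<in> der m" "p \<in> mball a (\<delta> a)" "q \<in> mball a (\<delta> a)"
        using \<rho>[OF x(1)] by blast
      then have "dist (f a) (f p) < e/2" "dist (f a) (f q) < e/2"
        using \<delta>(2) by auto
      then show ?thesis
        by (rule dist_triangle_half_r)
    qed
    have "dist (f y) (f x) < e"
      if "x \<in> mspace m" "y \<in> mspace m" "mdist m y x < min (\<rho>/2) \<eta>" for x y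
    \<comment> \<open>One point near the derived set suffices for \<open>near\<close>; if both are
      far from it, being closer than \<eta> makes them equal.\<close>
    proof (cases "y \<in> ball_around m (der m) (\<rho>/2) \<or> x \<in> ball_around m (der m) (\<rho>/2)")
      case True
      then show ?thesis
        using near[of y x] near[of x y] that by (auto simp: commute dist_commute)
    next
      case False
      then have "y = x"
        using \<eta>[of y x] that by force
      then show ?thesis
        using \<open>e > 0\<close> by simp
    qed
    then show ?thesis
      using \<open>\<rho> > 0\<close> \<open>\<eta> > 0\<close> by (intro exI[of _ "min (\<rho>/2) \<eta>"]) auto
  qed
  then show "uniformly_continuous_map m euclidean_metric f"
    by (simp add: uniformly_continuous_map_def)
qed

theorem theorem1:
  fixes m :: "'a metric"
  shows "uniformly_continuous_space m \<longleftrightarrow>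
           compactin (mtopology_of m) (der m) \<and>
           (\<forall>\<epsilon>>0. uniformly_isolated m (mspace m - ball_around m (der m) \<epsilon>))"
  using compactin_der_if_uniformly_continuous_space uniformly_continuous_space_if_compactin_der
    uniformly_isolated_if_no_limit_points[OF _ Diff_subset derived_set_Compl_ball_around_der]
  by blast

end
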